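(* Let $(X,\sigma)$ be a left non-degenerate braided set, with $\sigma(a,b)=({}^{a}b,a^b)$. (1) The operation $a\triangleleft_\sigma b=(b\cdot a)^b$ on $X$ is self-distributive, i.e. $(a\triangleleft_\sigma b)\triangleleft_\sigma c=(a\triangleleft_\sigma c)\triangleleft_\sigma(b\triangleleft_\sigma c)$ for all $a,b,c\in X$. (2) $(X,\triangleleft_\sigma)$ is a rack (i.e. the maps $a\mapsto a\triangleleft_\sigma b$ are bijective for all $b\in X$) if and only if $\sigma$ is invertible. (3) The shelf $(X,\triangleleft_\sigma)$ is trivial (i.e. $a\triangleleft_\sigma b=a$ for all $a,b\in X$) if and only if $\sigma$ is involutive, i.e. $\sigma\sigma=\mathrm{Id}$. (4) The following assertions are equivalent: (a) $(X,\triangleleft_\sigma)$ is a spindle, i.e. $a\triangleleft_\sigma a=a$ for all $a\in X$; (b) $\sigma$ is weakly RI-compatible, i.e. there exists a map $t\colon X\to X$ with $\sigma(t(a),a)=(t(a),a)$ for all $a\in X$; (c) $\sigma$ is weakly RI-compatible with $t(a)=a\cdot a=a\,\tilde{\cdot}\,a$ for all $a\in X$.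
   Context: A braided set is a set $X$ with a (not necessarily invertible) map $\sigma\colon X\times X\to X\times X$, $\sigma(a,b)=({}^{a}b,a^b)$, satisfying the Yang--Baxter equation $(\sigma\times\mathrm{Id})(\mathrm{Id}\times\sigma)(\sigma\times\mathrm{Id})=(\mathrm{Id}\times\sigma)(\sigma\times\mathrm{Id})(\mathrm{Id}\times\sigma)$ on $X^{\times3}$. It is left non-degenerate if for every $b\in X$ the map $a\mapsto a^b$ is a bijection $X\to X$. In that case, let $a\mapsto b\,\tilde{\cdot}\,a$ denote the inverse of $a\mapsto a^b$, and put $a\cdot b={}^{(b\,\tilde{\cdot}\,a)}b$. (Thus $\sigma(b\,\tilde{\cdot}\,a,\,b)=(a\cdot b,\,a)$.) A shelf is a set with a self-distributive operation. *)

theory Defs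
  imports Main "HOL-Library.FuncSet"
begin

text \<open>
  Structures live on a carrier set (possibly empty); nothing is assumed about the values of the
  maps outside the carrier.
\<close>

text \<open>The maps \<open>\<sigma> \<times> Id\<close> and \<open>Id \<times> \<sigma>\<close> on right-nested triples.\<close>

definition on_first_two :: "('a \<times> 'a \<Rightarrow> 'a \<times> 'a) \<Rightarrow> 'a \<times> 'a \<times> 'a \<Rightarrow> 'a \<times> 'a \<times> 'a" where
  "on_first_two \<sigma> = (\<lambda>(a, b, c). (fst (\<sigma> (a, b)), snd (\<sigma> (a, b)), c))"

definition on_last_two :: "('a \<times> 'a \<Rightarrow> 'a \<times> 'a) \<Rightarrow> 'a \<times> 'a \<times> 'a \<Rightarrow> 'a \<times> 'a \<times> 'a" where
  "on_last_two \<sigma> = map_prod id \<sigma>"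

definition yang_baxter :: "'a set \<Rightarrow> ('a \<times> 'a \<Rightarrow> 'a \<times> 'a) \<Rightarrow> bool" where
  "yang_baxter X \<sigma> \<longleftrightarrow>
     (\<forall>p \<in> X \<times> X \<times> X.
        (on_first_two \<sigma> \<circ> on_last_two \<sigma> \<circ> on_first_two \<sigma>) p =
        (on_last_two \<sigma> \<circ> on_first_two \<sigma> \<circ> on_last_two \<sigma>) p)"

definition braided_set :: "'a set \<Rightarrow> ('a \<times> 'a \<Rightarrow> 'a \<times> 'a) \<Rightarrow> bool" where
  "braided_set X \<sigma> \<longleftrightarrow> \<sigma> \<in> X \<times> X \<rightarrow> X \<times> X \<and> yang_baxter X \<sigma>"

text \<open>\<open>\<sigma> (a, b) = (lact \<sigma> a b, ract \<sigma> a b)\<close>, where \<open>lact \<sigma> a b\<close> is written with \<open>a\<close> as a left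
  superscript of \<open>b\<close>, and \<open>ract \<sigma> a b\<close> with \<open>b\<close> as a right superscript of \<open>a\<close>.\<close>

definition lact :: "('a \<times> 'a \<Rightarrow> 'a \<times> 'a) \<Rightarrow> 'a \<Rightarrow> 'a \<Rightarrow> 'a" where
  "lact \<sigma> a b = fst (\<sigma> (a, b))"

definition ract :: "('a \<times> 'a \<Rightarrow> 'a \<times> 'a) \<Rightarrow> 'a \<Rightarrow> 'a \<Rightarrow> 'a" where
  "ract \<sigma> a b = snd (\<sigma> (a, b))"

definition left_nondegenerate :: "'a set \<Rightarrow> ('a \<times> 'a \<Rightarrow> 'a \<times> 'a) \<Rightarrow> bool" where
  "left_nondegenerate X \<sigma> \<longleftrightarrow> (\<forall>b \<in> X. bij_betw (\<lambda>a. ract \<sigma> a b) X X)"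

text \<open>\<open>tdot X \<sigma> b a\<close> is \<open>b \<cdot>~ a\<close> (dot with a tilde): the value at \<open>a\<close> of the inverse of
  \<open>x \<mapsto> ract \<sigma> x b\<close>; it is meaningful only for left non-degenerate \<open>\<sigma>\<close>.\<close>

definition tdot :: "'a set \<Rightarrow> ('a \<times> 'a \<Rightarrow> 'a \<times> 'a) \<Rightarrow> 'a \<Rightarrow> 'a \<Rightarrow> 'a" where
  "tdot X \<sigma> b a = the_inv_into X (\<lambda>x. ract \<sigma> x b) a"

definition dot :: "'a set \<Rightarrow> ('a \<times> 'a \<Rightarrow> 'a \<times> 'a) \<Rightarrow> 'a \<Rightarrow> 'a \<Rightarrow> 'a" where
  "dot X \<sigma> a b = lact \<sigma> (tdot X \<sigma> b a) b"

definition shelf_op :: "'a set \<Rightarrow> ('a \<times> 'a \<Rightarrow> 'a \<times> 'a) \<Rightarrow> 'a \<Rightarrow> 'a \<Rightarrow> 'a" where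
  "shelf_op X \<sigma> a b = ract \<sigma> (dot X \<sigma> b a) b"

definition shelf :: "'a set \<Rightarrow> ('a \<Rightarrow> 'a \<Rightarrow> 'a) \<Rightarrow> bool" where
  "shelf X tr \<longleftrightarrow>
     (\<forall>a \<in> X. \<forall>b \<in> X. tr a b \<in> X) \<and>
     (\<forall>a \<in> X. \<forall>b \<in> X. \<forall>c \<in> X. tr (tr a b) c = tr (tr a c) (tr b c))"

definition rack :: "'a set \<Rightarrow> ('a \<Rightarrow> 'a \<Rightarrow> 'a) \<Rightarrow> bool" where
  "rack X tr \<longleftrightarrow> shelf X tr \<and> (\<forall>b \<in> X. bij_betw (\<lambda>a. tr a b) X X)"

definition trivial_shelf :: "'a set \<Rightarrow> ('a \<Rightarrow> 'a \<Rightarrow> 'a) \<Rightarrow> bool" where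
  "trivial_shelf X tr \<longleftrightarrow> shelf X tr \<and> (\<forall>a \<in> X. \<forall>b \<in> X. tr a b = a)"

definition spindle :: "'a set \<Rightarrow> ('a \<Rightarrow> 'a \<Rightarrow> 'a) \<Rightarrow> bool" where
  "spindle X tr \<longleftrightarrow> shelf X tr \<and> (\<forall>a \<in> X. tr a a = a)"

definition weakly_RI_compatible_with ::
    "'a set \<Rightarrow> ('a \<times> 'a \<Rightarrow> 'a \<times> 'a) \<Rightarrow> ('a \<Rightarrow> 'a) \<Rightarrow> bool" where
  "weakly_RI_compatible_with X \<sigma> t \<longleftrightarrow> t \<in> X \<rightarrow> X \<and> (\<forall>a \<in> X. \<sigma> (t a, a) = (t a, a))"

definition weakly_RI_compatible :: "'a set \<Rightarrow> ('a \<times> 'a \<Rightarrow> 'a \<times> 'a) \<Rightarrow> bool" where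
  "weakly_RI_compatible X \<sigma> \<longleftrightarrow> (\<exists>t. weakly_RI_compatible_with X \<sigma> t)"

end

theory Submission
  imports Defs
begin

text \<open>
  Write \<open>\<sigma>' (b, a) = (a \<triangleleft> b, b)\<close>. The guitar maps \<open>(x, a) \<mapsto> (x\<^sup>a, a)\<close> and
  \<open>(x, a, c) \<mapsto> ((x\<^sup>a)\<^sup>c, a\<^sup>c, c)\<close> are bijective by left non-degeneracy and intertwine \<open>\<sigma>\<close> with
  \<open>\<sigma>'\<close>. On triples this rests on the equivariance \<open>(a \<triangleleft> b)\<^sup>c = a\<^sup>c \<triangleleft> b\<^sup>c\<close>, a consequence of the
  Yang--Baxter equation for \<open>\<sigma>\<close>. Hence \<open>\<sigma>'\<close> satisfies the Yang--Baxter equation, which for a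
  map of this shape is self-distributivity, and invertibility, involutivity and fixed points can be
  read off from \<open>\<sigma>'\<close> instead of \<open>\<sigma>\<close>.
\<close>

definition guitar2 :: "('a \<times> 'a \<Rightarrow> 'a \<times> 'a) \<Rightarrow> 'a \<times> 'a \<Rightarrow> 'a \<times> 'a" where
  "guitar2 \<sigma> = (\<lambda>(x, a). (ract \<sigma> x a, a))"

definition guitar3 :: "('a \<times> 'a \<Rightarrow> 'a \<times> 'a) \<Rightarrow> 'a \<times> 'a \<times> 'a \<Rightarrow> 'a \<times> 'a \<times> 'a" where
  "guitar3 \<sigma> = (\<lambda>(x, a, c). (ract \<sigma> (ract \<sigma> x a) c, ract \<sigma> a c, c))"

definition shelf_braiding :: "('a \<Rightarrow> 'a \<Rightarrow> 'a) \<Rightarrow> 'a \<times> 'a \<Rightarrow> 'a \<times> 'a" where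
  "shelf_braiding tr = (\<lambda>(b, a). (tr a b, b))"

lemma shelf_braiding_apply [simp]: "shelf_braiding tr (b, a) = (tr a b, b)"
  by (simp add: shelf_braiding_def)

text \<open>The entry \<open>b\<close> survives in the output, so the map splits into one map per
  \<open>b\<close>, from pairs with first entry \<open>b\<close> to pairs with second entry
  \<open>b\<close>, each given by right translation by \<open>b\<close>.\<close>

lemma bij_betw_shelf_braiding_iff:
  "bij_betw (shelf_braiding tr) (X \<times> X) (X \<times> X) \<longleftrightarrow> (\<forall>b \<in> X. bij_betw (\<lambda>a. tr a b) X X)"
proof
  assume bij: "bij_betw (shelf_braiding tr) (X \<times> X) (X \<times> X)"
  show "\<forall>b \<in> X. bij_betw (\<lambda>a. tr a b) X X"
  proof
    fix b assume b: "b \<in> X"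
    show "bij_betw (\<lambda>a. tr a b) X X"
      unfolding bij_betw_def
    proof
      show "inj_on (\<lambda>a. tr a b) X"
        using inj_onD[OF bij_betw_imp_inj_on[OF bij], of "(b, _)" "(b, _)"] b
        by (auto intro!: inj_onI)
      show "(\<lambda>a. tr a b) ` X = X"
      proof
        show "(\<lambda>a. tr a b) ` X \<subseteq> X"
          using bij_betwE[OF bij] b by fastforce
        show "X \<subseteq> (\<lambda>a. tr a b) ` X"
        proof
          fix y assume "y \<in> X"
          then have "(y, b) \<in> shelf_braiding tr ` (X \<times> X)"
            using b bij_betw_imp_surj_on[OF bij] by blast
          then show "y \<in> (\<lambda>a. tr a b) ` X" by auto
        qed
      qed
    qed
  qed
next
  assume bij: "\<forall>b \<in> X. bij_betw (\<lambda>a. tr a b) X X"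
  show "bij_betw (shelf_braiding tr) (X \<times> X) (X \<times> X)"
    unfolding bij_betw_def
  proof
    show "inj_on (shelf_braiding tr) (X \<times> X)"
      using bij by (auto intro!: inj_onI dest!: bspec bij_betw_imp_inj_on dest: inj_onD)
    show "shelf_braiding tr ` (X \<times> X) = X \<times> X"
    proof
      show "shelf_braiding tr ` (X \<times> X) \<subseteq> X \<times> X"
        using bij by (fastforce simp: bij_betw_def)
      show "X \<times> X \<subseteq> shelf_braiding tr ` (X \<times> X)"
      proof clarify
        fix y b assume "y \<in> X" "b \<in> X"
        moreover then obtain a where "a \<in> X" "y = tr a b"
          using bij by (metis bij_betw_imp_surj_on imageE)
        ultimately show "(y, b) \<in> shelf_braiding tr ` (X \<times> X)"
          by (auto intro!: image_eqI[of _ _ "(b, a)"])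
      qed
    qed
  qed
qed

text \<open>The second entry of the square at \<open>(b, a)\<close> is \<open>tr a b\<close>, so
  involutivity forces triviality. Conversely, a trivial operation makes the map the flip.\<close>

lemma shelf_braiding_involutive_iff:
  "(\<forall>p \<in> X \<times> X. shelf_braiding tr (shelf_braiding tr p) = p) \<longleftrightarrow>
    (\<forall>a \<in> X. \<forall>b \<in> X. tr a b = a)"
proof
  assume inv: "\<forall>p \<in> X \<times> X. shelf_braiding tr (shelf_braiding tr p) = p"
  show "\<forall>a \<in> X. \<forall>b \<in> X. tr a b = a"
  proof (intro ballI)
    fix a b assume "a \<in> X" "b \<in> X"
    then show "tr a b = a"
      using bspec[OF inv, of "(b, a)"] by simp
  qed
qed simp

locale lnd_braided_set =
  fixes X :: "'a set" and \<sigma> :: "'a \<times> 'a \<Rightarrow> 'a \<times> 'a"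
  assumes braided: "braided_set X \<sigma>"
    and left_nondeg: "left_nondegenerate X \<sigma>"
begin

abbreviation L where "L \<equiv> lact \<sigma>"
abbreviation R where "R \<equiv> ract \<sigma>"
abbreviation op (infixl "\<triangleleft>" 70) where "a \<triangleleft> b \<equiv> shelf_op X \<sigma> a b"
abbreviation \<sigma>' where "\<sigma>' \<equiv> shelf_braiding (shelf_op X \<sigma>)"

lemma sigma_eq: "\<sigma> (a, b) = (L a b, R a b)"
  by (simp add: lact_def ract_def)

lemma sigma_closed: "p \<in> X \<times> X \<Longrightarrow> \<sigma> p \<in> X \<times> X"
  using braided by (auto simp: braided_set_def)

lemma L_closed [simp]: "a \<in> X \<Longrightarrow> b \<in> X \<Longrightarrow> L a b \<in> X"
  and R_closed [simp]: "a \<in> X \<Longrightarrow> b \<in> X \<Longrightarrow> R a b \<in> X"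
  using sigma_closed[of "(a, b)"] by (auto simp: sigma_eq)

text \<open>These are the second and third components of the Yang--Baxter equation at
  \<open>(a, b, c)\<close>. Together they yield the equivariance \<open>R_op\<close>.\<close>

lemma
  assumes "a \<in> X" "b \<in> X" "c \<in> X"
  shows yang_baxter_middle: "R (L a b) (L (R a b) c) = L (R a (L b c)) (R b c)"
    and yang_baxter_right: "R (R a b) c = R (R a (L b c)) (R b c)"
proof -
  have "(on_first_two \<sigma> \<circ> on_last_two \<sigma> \<circ> on_first_two \<sigma>) (a, b, c) =
        (on_last_two \<sigma> \<circ> on_first_two \<sigma> \<circ> on_last_two \<sigma>) (a, b, c)"
    using braided assms unfolding braided_set_def yang_baxter_def by blast
  then show "R (L a b) (L (R a b) c) = L (R a (L b c)) (R b c)"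
    and "R (R a b) c = R (R a (L b c)) (R b c)"
    by (simp_all add: on_first_two_def on_last_two_def sigma_eq)
qed

lemma bij_R: "b \<in> X \<Longrightarrow> bij_betw (\<lambda>a. R a b) X X"
  using left_nondeg by (simp add: left_nondegenerate_def)

lemma R_inject: "a \<in> X \<Longrightarrow> a' \<in> X \<Longrightarrow> b \<in> X \<Longrightarrow> R a b = R a' b \<longleftrightarrow> a = a'"
  using bij_R by (meson bij_betw_imp_inj_on inj_on_eq_iff)

lemma tdot_closed [simp]: "a \<in> X \<Longrightarrow> b \<in> X \<Longrightarrow> tdot X \<sigma> b a \<in> X"
  unfolding tdot_def
  by (metis bij_R bij_betw_def subset_refl the_inv_into_into)

lemma R_tdot [simp]: "a \<in> X \<Longrightarrow> b \<in> X \<Longrightarrow> R (tdot X \<sigma> b a) b = a"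
  unfolding tdot_def by (rule f_the_inv_into_f_bij_betw[OF bij_R]) auto

lemma tdot_R [simp]: "a \<in> X \<Longrightarrow> b \<in> X \<Longrightarrow> tdot X \<sigma> b (R a b) = a"
  by (rule iffD1[OF R_inject[of _ _ b]]) auto

lemma op_closed [simp]: "a \<in> X \<Longrightarrow> b \<in> X \<Longrightarrow> a \<triangleleft> b \<in> X"
  by (simp add: shelf_op_def dot_def)

text \<open>Writing the right operand as \<open>R x a\<close> eliminates \<open>tdot\<close>. This
  is the form in which the first entries of \<open>guitar2 \<sigma> (\<sigma> (x, a))\<close> and
  \<open>\<sigma>' (guitar2 \<sigma> (x, a))\<close> are compared.\<close>

lemma op_R: "x \<in> X \<Longrightarrow> a \<in> X \<Longrightarrow> a \<triangleleft> R x a = R (L x a) (R x a)"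
  by (simp add: shelf_op_def dot_def)

lemma R_op:
  assumes "a \<in> X" "b \<in> X" "c \<in> X"
  shows "R (a \<triangleleft> b) c = R a c \<triangleleft> R b c"
proof -
  define x where "x = tdot X \<sigma> a b"
  have x: "x \<in> X" and b: "b = R x a"
    using assms by (simp_all add: x_def)
  \<comment> \<open>After \<open>c\<close> has acted, \<open>y\<close> plays for
    \<open>R a c\<close> and \<open>R b c\<close> the role that \<open>x\<close> plays for
    \<open>a\<close> and \<open>b\<close>, so that \<open>op_R\<close> applies again at the
    end.\<close>
  define y where "y = R x (L a c)"
  have y: "y \<in> X" using x assms by (simp add: y_def)
  have Rbc: "R b c = R y (R a c)"
    unfolding b y_def using x assms by (intro yang_baxter_right)
  have "R (a \<triangleleft> b) c = R (R (L x a) b) c"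
    using x assms by (simp add: b op_R)
  also have "\<dots> = R (R (L x a) (L b c)) (R b c)"
    using x assms by (intro yang_baxter_right) auto
  also have "R (L x a) (L b c) = L y (R a c)"
    unfolding b y_def using x assms by (intro yang_baxter_middle) auto
  also have "R (L y (R a c)) (R b c) = R a c \<triangleleft> R b c"
    unfolding Rbc using y assms by (simp add: op_R)
  finally show ?thesis .
qed

lemma bij_guitar2: "bij_betw (guitar2 \<sigma>) (X \<times> X) (X \<times> X)"
  by (rule bij_betw_byWitness[where f' = "\<lambda>(b, a). (tdot X \<sigma> a b, a)"])
    (auto simp: guitar2_def)

lemma guitar2_sigma: "p \<in> X \<times> X \<Longrightarrow> guitar2 \<sigma> (\<sigma> p) = \<sigma>' (guitar2 \<sigma> p)"
  by (auto simp: guitar2_def sigma_eq op_R)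

text \<open>Equivariance enters here: on the right \<open>\<sigma>'\<close> meets entries on which
  \<open>c\<close> has already acted, and \<open>R_op\<close> pulls this action out of the
  operation.\<close>

lemma guitar3_first:
  "p \<in> X \<times> X \<times> X \<Longrightarrow> guitar3 \<sigma> (on_first_two \<sigma> p) = on_first_two \<sigma>' (guitar3 \<sigma> p)"
  by (auto simp: guitar3_def on_first_two_def sigma_eq simp flip: op_R R_op)

text \<open>The first entries agree by \<open>yang_baxter_right\<close>, the second ones by
  \<open>op_R\<close>.\<close>

lemma guitar3_last:
  "p \<in> X \<times> X \<times> X \<Longrightarrow> guitar3 \<sigma> (on_last_two \<sigma> p) = on_last_two \<sigma>' (guitar3 \<sigma> p)"
  by (auto simp: guitar3_def on_last_two_def sigma_eq op_R simp flip: yang_baxter_right)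

lemma shelf_op_shelf: "shelf X (shelf_op X \<sigma>)"
  unfolding shelf_def
proof (intro conjI ballI)
  fix a b c assume abc: "a \<in> X" "b \<in> X" "c \<in> X"
  \<comment> \<open>The preimage of \<open>(c, b, a)\<close> under \<open>guitar3 \<sigma>\<close>,
    found by solving for the entries from right to left.\<close>
  define p where "p = (tdot X \<sigma> (tdot X \<sigma> a b) (tdot X \<sigma> a c), tdot X \<sigma> a b, a)"
  have p: "p \<in> X \<times> X \<times> X" and guitar_p: "guitar3 \<sigma> p = (c, b, a)"
    using abc by (simp_all add: p_def guitar3_def)
  have closed: "on_first_two \<sigma> q \<in> X \<times> X \<times> X" "on_last_two \<sigma> q \<in> X \<times> X \<times> X"
    if "q \<in> X \<times> X \<times> X" for q
    using that by (auto simp: on_first_two_def on_last_two_def sigma_eq)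
  have "on_first_two \<sigma>' (on_last_two \<sigma>' (on_first_two \<sigma>' (c, b, a))) =
      guitar3 \<sigma> ((on_first_two \<sigma> \<circ> on_last_two \<sigma> \<circ> on_first_two \<sigma>) p)"
    using p closed by (simp add: guitar3_first guitar3_last guitar_p)
  also have "\<dots> = guitar3 \<sigma> ((on_last_two \<sigma> \<circ> on_first_two \<sigma> \<circ> on_last_two \<sigma>) p)"
    using braided p unfolding braided_set_def yang_baxter_def by (intro arg_cong[of _ _ "guitar3 \<sigma>"]) blast
  also have "\<dots> = on_last_two \<sigma>' (on_first_two \<sigma>' (on_last_two \<sigma>' (c, b, a)))"
    using p closed by (simp add: guitar3_first guitar3_last guitar_p)
  \<comment> \<open>The first entries of the two triples are
    \<open>(a \<triangleleft> c) \<triangleleft> (b \<triangleleft> c)\<close> and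
    \<open>(a \<triangleleft> b) \<triangleleft> c\<close>; this is why the triple is taken in
    reversed order.\<close>
  finally show "a \<triangleleft> b \<triangleleft> c = (a \<triangleleft> c) \<triangleleft> (b \<triangleleft> c)"
    by (simp add: on_first_two_def on_last_two_def)
qed simp

lemma rack_iff: "rack X (shelf_op X \<sigma>) \<longleftrightarrow> bij_betw \<sigma> (X \<times> X) (X \<times> X)"
proof -
  have "rack X (shelf_op X \<sigma>) \<longleftrightarrow> bij_betw \<sigma>' (X \<times> X) (X \<times> X)"
    by (simp add: rack_def shelf_op_shelf bij_betw_shelf_braiding_iff)
  also have "\<dots> \<longleftrightarrow> bij_betw (\<sigma>' \<circ> guitar2 \<sigma>) (X \<times> X) (X \<times> X)"
    using bij_guitar2 by (rule bij_betw_comp_iff)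
  also have "\<dots> \<longleftrightarrow> bij_betw (guitar2 \<sigma> \<circ> \<sigma>) (X \<times> X) (X \<times> X)"
    by (rule bij_betw_cong) (simp add: guitar2_sigma)
  also have "\<dots> \<longleftrightarrow> bij_betw \<sigma> (X \<times> X) (X \<times> X)"
    using bij_guitar2 by (rule bij_betw_comp_iff2[symmetric]) (use sigma_closed in blast)
  finally show ?thesis .
qed

lemma guitar2_inject: "p \<in> X \<times> X \<Longrightarrow> q \<in> X \<times> X \<Longrightarrow> guitar2 \<sigma> p = guitar2 \<sigma> q \<longleftrightarrow> p = q"
  using bij_guitar2 by (meson bij_betw_imp_inj_on inj_on_eq_iff)

lemma trivial_iff: "trivial_shelf X (shelf_op X \<sigma>) \<longleftrightarrow> (\<forall>p \<in> X \<times> X. \<sigma> (\<sigma> p) = p)"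
proof -
  have "\<sigma> (\<sigma> p) = p \<longleftrightarrow> \<sigma>' (\<sigma>' (guitar2 \<sigma> p)) = guitar2 \<sigma> p" if "p \<in> X \<times> X" for p
    using that sigma_closed guitar2_inject[of "\<sigma> (\<sigma> p)" p] by (simp add: guitar2_sigma)
  \<comment> \<open>The pointwise equivalence speaks only of pairs in the image of
    \<open>guitar2 \<sigma>\<close>; surjectivity then extends it to all pairs.\<close>
  then have "(\<forall>p \<in> X \<times> X. \<sigma> (\<sigma> p) = p) \<longleftrightarrow> (\<forall>p \<in> guitar2 \<sigma> ` (X \<times> X). \<sigma>' (\<sigma>' p) = p)"
    by blast
  then have "(\<forall>p \<in> X \<times> X. \<sigma> (\<sigma> p) = p) \<longleftrightarrow> (\<forall>p \<in> X \<times> X. \<sigma>' (\<sigma>' p) = p)"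
    unfolding bij_betw_imp_surj_on[OF bij_guitar2] .
  then show ?thesis
    unfolding trivial_shelf_def shelf_braiding_involutive_iff using shelf_op_shelf by blast
qed

text \<open>Under \<open>guitar2\<close>, fixed points of \<open>\<sigma>\<close> correspond to
  those of \<open>\<sigma>'\<close>, which are the diagonal pairs \<open>(a, a)\<close> with
  \<open>a\<close> idempotent.\<close>

lemma sigma_fixed_iff:
  assumes "a \<in> X" "x \<in> X"
  shows "\<sigma> (x, a) = (x, a) \<longleftrightarrow> a \<triangleleft> a = a \<and> x = tdot X \<sigma> a a"
proof -
  have "\<sigma> (x, a) = (x, a) \<longleftrightarrow> \<sigma>' (R x a, a) = (R x a, a)"
    using assms sigma_closed[of "(x, a)"] guitar2_inject[of "\<sigma> (x, a)" "(x, a)"]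
    by (simp add: guitar2_sigma) (simp add: guitar2_def)
  also have "\<dots> \<longleftrightarrow> a \<triangleleft> a = a \<and> R x a = a"
    by auto
  also have "R x a = a \<longleftrightarrow> x = tdot X \<sigma> a a"
    using assms R_tdot tdot_R by metis
  finally show ?thesis .
qed

text \<open>At most one fixed point of \<open>\<sigma>\<close> has second entry \<open>a\<close>, so
  \<open>t\<close> is determined on \<open>X\<close>, and it exists exactly when every element is
  idempotent.\<close>

lemma weakly_RI_compatible_with_iff:
  "weakly_RI_compatible_with X \<sigma> t \<longleftrightarrow>
    spindle X (shelf_op X \<sigma>) \<and> (\<forall>a \<in> X. t a = tdot X \<sigma> a a)"
proof
  assume "weakly_RI_compatible_with X \<sigma> t"
  then have "a \<triangleleft> a = a \<and> t a = tdot X \<sigma> a a" if "a \<in> X" for a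
    using that by (simp add: weakly_RI_compatible_with_def Pi_iff flip: sigma_fixed_iff)
  then show "spindle X (shelf_op X \<sigma>) \<and> (\<forall>a \<in> X. t a = tdot X \<sigma> a a)"
    by (simp add: spindle_def shelf_op_shelf)
next
  assume "spindle X (shelf_op X \<sigma>) \<and> (\<forall>a \<in> X. t a = tdot X \<sigma> a a)"
  then show "weakly_RI_compatible_with X \<sigma> t"
    by (simp add: weakly_RI_compatible_with_def spindle_def sigma_fixed_iff)
qed

lemma spindle_iff: "spindle X (shelf_op X \<sigma>) \<longleftrightarrow> weakly_RI_compatible X \<sigma>"
  unfolding weakly_RI_compatible_def weakly_RI_compatible_with_iff
  by (auto intro: exI[of _ "\<lambda>a. tdot X \<sigma> a a"])

text \<open>Since \<open>t a\<close> is \<open>tdot X \<sigma> a a\<close>, the first component of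
  the fixed-point equation evaluates \<open>dot X \<sigma> a a\<close> to
  \<open>t a\<close>.\<close>

lemma weakly_RI_compatible_with_dot:
  assumes "weakly_RI_compatible_with X \<sigma> t" "a \<in> X"
  shows "t a = dot X \<sigma> a a \<and> dot X \<sigma> a a = tdot X \<sigma> a a"
proof -
  have "t a = tdot X \<sigma> a a"
    using assms by (simp add: weakly_RI_compatible_with_iff)
  moreover have "L (t a) a = t a"
    using assms by (simp add: weakly_RI_compatible_with_def lact_def)
  ultimately show ?thesis
    by (simp add: dot_def)
qed

end

theorem proposition5p7:
  fixes X :: "'a set" and \<sigma> :: "'a \<times> 'a \<Rightarrow> 'a \<times> 'a"
  assumes "braided_set X \<sigma>" and "left_nondegenerate X \<sigma>"
  shows "shelf X (shelf_op X \<sigma>) \<and>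
         (rack X (shelf_op X \<sigma>) \<longleftrightarrow> bij_betw \<sigma> (X \<times> X) (X \<times> X)) \<and>
         (trivial_shelf X (shelf_op X \<sigma>) \<longleftrightarrow> (\<forall>p \<in> X \<times> X. \<sigma> (\<sigma> p) = p)) \<and>
         (spindle X (shelf_op X \<sigma>) \<longleftrightarrow> weakly_RI_compatible X \<sigma>) \<and>
         (weakly_RI_compatible X \<sigma> \<longleftrightarrow>
           (\<exists>t. weakly_RI_compatible_with X \<sigma> t \<and>
                (\<forall>a \<in> X. t a = dot X \<sigma> a a \<and> dot X \<sigma> a a = tdot X \<sigma> a a)))"
proof -
  interpret lnd_braided_set X \<sigma>
    using assms by unfold_locales
  \<comment> \<open>The same \<open>t\<close> serves on both sides, as every admissible
    \<open>t\<close> already satisfies the two formulas.\<close>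
  have "weakly_RI_compatible X \<sigma> \<longleftrightarrow>
      (\<exists>t. weakly_RI_compatible_with X \<sigma> t \<and>
           (\<forall>a \<in> X. t a = dot X \<sigma> a a \<and> dot X \<sigma> a a = tdot X \<sigma> a a))"
    unfolding weakly_RI_compatible_def using weakly_RI_compatible_with_dot by blast
  with shelf_op_shelf rack_iff trivial_iff spindle_iff show ?thesis
    by blast
qed

end
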